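(* Let $z_0\in\mathbb{C}\setminus[-1,1]$ and $f(x)=\frac{1}{x-z_0}$. Let $a_n^L=(n+\tfrac12)\int_{-1}^1f(x)P_n(x)\,dx$ and $a_n^C=\frac{2}{\pi}\int_{-1}^1\frac{f(x)T_n(x)}{\sqrt{1-x^2}}dx$ be its Legendre and Chebyshev coefficients and $\gamma_n=a_n^L/a_n^C$. Then \[ \gamma_n=g(z_0)\sqrt{n\pi}+\mathcal{O}(n^{-1/2}),\qquad n\to\infty, \] where \[ g(z)=\sqrt{\frac{z^2-1}{(z\pm\sqrt{z^2-1})^2-1}}, \] with the sign chosen so that $|z\pm\sqrt{z^2-1}|>1$ and the branch chosen so that $g(z)>0$ for $z>1$.
   Context: $P_n$ is the Legendre polynomial and $T_n$ the Chebyshev polynomial of the first kind of degree $n$; $f=\sum_n a_n^LP_n$ and $f=\sum_n{}' a_n^CT_n$ (first Chebyshev term halved). *)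

theory Defs
  imports "HOL-Analysis.Analysis" "HOL-Library.Landau_Symbols"
begin

fun legendreP :: "nat \<Rightarrow> real \<Rightarrow> real" where
  "legendreP 0 x = 1"
| "legendreP (Suc 0) x = x"
| "legendreP (Suc (Suc n)) x =
     ((2 * real n + 3) * x * legendreP (Suc n) x - (real n + 1) * legendreP n x) / (real n + 2)"

fun chebyshevT :: "nat \<Rightarrow> real \<Rightarrow> real" where
  "chebyshevT 0 x = 1"
| "chebyshevT (Suc 0) x = x"
| "chebyshevT (Suc (Suc n)) x = 2 * x * chebyshevT (Suc n) x - chebyshevT n x"

definition legendre_coeff :: "(real \<Rightarrow> complex) \<Rightarrow> nat \<Rightarrow> complex" where
  "legendre_coeff f n =
     of_real (real n + 1/2) * integral {-1..1} (\<lambda>x. f x * of_real (legendreP n x))"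

definition chebyshev_coeff :: "(real \<Rightarrow> complex) \<Rightarrow> nat \<Rightarrow> complex" where
  "chebyshev_coeff f n =
     of_real (2 / pi) * integral {-1..1} (\<lambda>x. f x * of_real (chebyshevT n x / sqrt (1 - x\<^sup>2)))"

definition joukowski_out :: "complex \<Rightarrow> complex" where
  "joukowski_out z =
     (if cmod (z + csqrt (z\<^sup>2 - 1)) > 1 then z + csqrt (z\<^sup>2 - 1) else z - csqrt (z\<^sup>2 - 1))"

text \<open>g(z) = sqrt((z^2-1)/((z \<plusminus> sqrt(z^2-1))^2-1)); the radicand equals (1 - w^{-2})/4 with |w|>1,
  which lies in the open right half plane, so the principal square root is the branch that is
  analytic on C \ [-1,1] and positive for z > 1.\<close>
definition g_fun :: "complex \<Rightarrow> complex" where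
  "g_fun z = csqrt ((z\<^sup>2 - 1) / ((joukowski_out z)\<^sup>2 - 1))"

end

(* Put u = 1/w, where w is the value of the Joukowski inverse at z outside the unit disc. The
   generating function of the U_k gives 1/(z - x) = 2 * sum_k u^(k+1) U_k(x), uniformly on [-1,1].
   The moments of P_n against U_k follow from the recurrences: they vanish unless k = n + 2j, when
   they equal c_j * d_(n+j), where c_j are the coefficients of (1-x)^(-1/2) and
   d_m = sqrt pi * Gamma(m+1) / Gamma(m+3/2). The n-th Chebyshev coefficient is an explicit multiple
   of u^n, so the ratio of the coefficients is (1-u^2)/2 * sum_j c_j (n+1/2) d_(n+j) u^(2j).
   Wallis' product yields pi/(m+1) <= d_m^2 <= pi/(m+1/2), hence (n+1/2) d_(n+j) differs from
   sqrt(n pi) by O((j+1)/sqrt n), and the sum of c_j u^(2j) is (1-u^2)^(-1/2). *)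
theory Submission
  imports Defs
begin

section \<open>Chebyshev polynomials\<close>

text \<open>The Chebyshev polynomial of the second kind with its index shifted by one:
  \<open>chebyshevV k\<close> is the usual $U_{k-1}$. The shift makes the recurrence hold down to index 0.\<close>
fun chebyshevV :: "nat \<Rightarrow> real \<Rightarrow> real" where
  "chebyshevV 0 x = 0"
| "chebyshevV (Suc 0) x = 1"
| "chebyshevV (Suc (Suc n)) x = 2 * x * chebyshevV (Suc n) x - chebyshevV n x"

lemma continuous_legendreP: "continuous_on A (legendreP n)"
proof (induction n rule: induct_nat_012)
  case (ge2 n)
  then show ?case
    unfolding legendreP.simps by (auto intro!: continuous_intros)
qed auto

lemma continuous_chebyshevV: "continuous_on A (chebyshevV n)"
  by (induction n rule: induct_nat_012) (auto intro!: continuous_intros)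

lemma chebyshevT_cos: "chebyshevT n (cos t) = cos (real n * t)"
proof (induction n rule: induct_nat_012)
  case (ge2 n)
  have "cos ((real n + 2) * t) + cos (real n * t) = 2 * cos t * cos ((real n + 1) * t)"
    using cos_plus_cos[of "(real n + 2) * t" "real n * t"]
    by (simp add: algebra_simps add_divide_distrib)
  with ge2 show ?case
    by (simp add: algebra_simps)
qed auto

lemma abs_chebyshevT_le_1:
  assumes "\<bar>x\<bar> \<le> 1"
  shows "\<bar>chebyshevT n x\<bar> \<le> 1"
  using chebyshevT_cos[of n "arccos x"] assms by (simp add: cos_arccos_abs)

lemma chebyshevT_eq_V: "chebyshevT (Suc n) x = x * chebyshevV (Suc n) x - chebyshevV n x"
proof (induction n rule: induct_nat_012)
  case (ge2 n)
  have "chebyshevT (Suc (Suc (Suc n))) x = 2 * x * chebyshevT (Suc (Suc n)) x - chebyshevT (Suc n) x"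
    by simp
  then show ?case
    unfolding ge2 by (simp add: algebra_simps)
qed (auto simp: algebra_simps)

lemma chebyshevV_Suc: "chebyshevV (Suc n) x = x * chebyshevV n x + chebyshevT n x"
  by (cases n) (simp_all add: chebyshevT_eq_V)

text \<open>The three-term recurrence with the triangle inequality would only give exponential
  growth; \<open>chebyshevV_Suc\<close> instead adds a term of modulus at most 1 at each
  step.\<close>

lemma abs_chebyshevV_le:
  assumes "\<bar>x\<bar> \<le> 1"
  shows "\<bar>chebyshevV n x\<bar> \<le> real n"
proof (induction n)
  case (Suc n)
  have "\<bar>x * chebyshevV n x\<bar> \<le> 1 * real n"
    unfolding abs_mult using assms Suc by (intro mult_mono) auto
  then show ?case
    using abs_chebyshevT_le_1[OF assms, of n] unfolding chebyshevV_Suc by linarith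
qed auto

lemma chebyshevT_deriv:
  "(chebyshevT n has_real_derivative real n * chebyshevV n x) (at x)"
proof (induction n rule: induct_nat_012)
  case (ge2 n)
  have "((\<lambda>x. 2 * x * chebyshevT (Suc n) x - chebyshevT n x) has_real_derivative
      2 * chebyshevT (Suc n) x + 2 * x * (real (Suc n) * chebyshevV (Suc n) x)
        - real n * chebyshevV n x) (at x)"
    by (auto intro!: derivative_eq_intros ge2)
  \<comment> \<open>Writing T_(n+1) as x V_(n+1) - V_n raises both factors n + 1 and n to n +
    2.\<close>
  also have "2 * chebyshevT (Suc n) x + 2 * x * (real (Suc n) * chebyshevV (Suc n) x)
        - real n * chebyshevV n x = real (Suc (Suc n)) * chebyshevV (Suc (Suc n)) x"
    by (simp add: chebyshevT_eq_V algebra_simps)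
  finally show ?case
    by simp
qed (auto simp: fun_eq_iff intro!: derivative_eq_intros)

lemma chebyshevT_1: "chebyshevT n 1 = 1"
  using chebyshevT_cos[of n 0] by simp

lemma chebyshevT_minus_1: "chebyshevT n (-1) = (-1) ^ n"
  by (induction n rule: induct_nat_012) auto

text \<open>For n > 0 an antiderivative is T_n / n, with endpoint values 1/n and (-1)^n / n; V_0 is
  zero.\<close>

lemma chebyshevV_has_integral:
  "(chebyshevV n has_integral (if odd n then 2 / real n else 0)) {-1..1}"
proof (cases "n = 0")
  case True
  then show ?thesis by (simp add: has_integral_0_eq cong: has_integral_cong)
next
  case False
  have "((\<lambda>x. real n * chebyshevV n x) has_integral chebyshevT n 1 - chebyshevT n (-1)) {-1..1}"
    using chebyshevT_deriv[of n]
    by (intro fundamental_theorem_of_calculus)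
      (auto simp: has_real_derivative_iff_has_vector_derivative
        intro: has_vector_derivative_at_within)
  from has_integral_mult_right[OF this, of "1 / real n"] False show ?thesis
    by (auto simp: chebyshevT_1 chebyshevT_minus_1)
qed

section \<open>Moments of Legendre polynomials\<close>

text \<open>The coefficients of $(1-x)^{-1/2}$.\<close>
definition half_coeff :: "nat \<Rightarrow> real" where
  "half_coeff j = pochhammer (1/2) j / fact j"

text \<open>This equals $\sqrt\pi\,\Gamma(m+1)/\Gamma(m+3/2)$.\<close>
definition half_ratio :: "nat \<Rightarrow> real" where
  "half_ratio m = fact m / pochhammer (1/2) (Suc m)"

lemma half_coeff_0 [simp]: "half_coeff 0 = 1"
  by (simp add: half_coeff_def)

lemma half_coeff_Suc: "half_coeff (Suc j) = half_coeff j * (real j + 1/2) / (real j + 1)"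
  by (simp add: half_coeff_def pochhammer_Suc field_simps)

lemma half_coeff_nonneg: "half_coeff j \<ge> 0"
  by (simp add: half_coeff_def pochhammer_nonneg)

lemma half_coeff_le_1: "half_coeff j \<le> 1"
proof (induction j)
  case (Suc j)
  have "half_coeff j * ((real j + 1/2) / (real j + 1)) \<le> 1 * 1"
    using Suc half_coeff_nonneg[of j] by (intro mult_mono) auto
  then show ?case
    by (simp add: half_coeff_Suc)
qed auto

lemma half_ratio_0: "half_ratio 0 = 2"
  by (simp add: half_ratio_def)

lemma half_ratio_Suc: "half_ratio (Suc m) = half_ratio m * (real m + 1) / (real m + 3/2)"
proof -
  have eq: "pochhammer (1/2::real) (Suc (Suc m)) = pochhammer (1/2) (Suc m) * (real m + 3/2)"
    by (subst pochhammer_Suc) (simp add: algebra_simps)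
  show ?thesis
    unfolding half_ratio_def eq by (simp add: algebra_simps)
qed

lemma half_ratio_pos: "half_ratio m > 0"
  by (simp add: half_ratio_def pochhammer_pos)

text \<open>Everything cancels except the last Pochhammer factor j + 1/2. The value is the integral
  of U_(2j), which makes the closed form of the moments right at n = 0.\<close>

lemma half_coeff_times_ratio: "half_coeff j * half_ratio j = 2 / (2 * real j + 1)"
proof -
  have "pochhammer (1/2::real) j > 0" by (rule pochhammer_pos) auto
  then show ?thesis
    by (simp add: half_coeff_def half_ratio_def pochhammer_Suc divide_simps)
qed

text \<open>The integral of $P_n U_{k-1}$ over $[-1,1]$.\<close>
definition legendre_moment :: "nat \<Rightarrow> nat \<Rightarrow> real" where
  "legendre_moment n k =
     (if k \<le> n \<or> even (k - n) then 0
      else half_coeff ((k - n) div 2) * half_ratio (n + (k - n) div 2))"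

lemma legendre_moment_odd [simp]:
  "legendre_moment n (Suc (n + 2 * j)) = half_coeff j * half_ratio (n + j)"
  by (simp add: legendre_moment_def Suc_diff_le)

lemma legendre_moment_small: "k \<le> n \<Longrightarrow> legendre_moment n k = 0"
  by (simp add: legendre_moment_def)

lemma legendre_moment_parity: "even (k + n) \<Longrightarrow> legendre_moment n k = 0"
  by (auto simp: legendre_moment_def)

lemma legendre_moment_0: "legendre_moment 0 k = (if odd k then 2 / real k else 0)"
proof (cases "even k")
  case True
  then show ?thesis by (simp add: legendre_moment_def)
next
  case False
  then obtain j where "k = Suc (0 + 2 * j)" by (auto elim!: oddE)
  then show ?thesis
    by (simp only: legendre_moment_odd) (simp add: half_coeff_times_ratio add.commute)
qed

text \<open>Reflects P_1(x) = x together with 2 x V_(m+1) = V_(m+2) + V_m.\<close>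

lemma legendre_moment_1:
  "legendre_moment 1 (Suc m) = (legendre_moment 0 (Suc (Suc m)) + legendre_moment 0 m) / 2"
proof (cases "even m")
  case True
  then show ?thesis by (simp add: legendre_moment_parity)
next
  case False
  then obtain j where j: "m = Suc (0 + 2 * j)" by (auto elim!: oddE)
  have 1: "legendre_moment 1 (Suc m) = half_coeff j * half_ratio (Suc j)"
    using legendre_moment_odd[of 1 j] j by simp
  have 2: "legendre_moment 0 (Suc (Suc m)) = half_coeff (Suc j) * half_ratio (Suc j)"
    using legendre_moment_odd[of 0 "Suc j"] j by simp
  have 3: "legendre_moment 0 m = half_coeff j * half_ratio j"
    using legendre_moment_odd[of 0 j] j by simp
  show ?thesis
    unfolding 1 2 3
    by (simp add: half_coeff_Suc half_ratio_Suc divide_simps) (simp add: algebra_simps)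
qed

text \<open>This is Bonnet's recurrence for P_(n+2) paired with V_(m+1), the factor x being moved to
  the other polynomial by 2 x V_(m+1) = V_(m+2) + V_m.\<close>

lemma legendre_moment_Suc_Suc:
  "legendre_moment (Suc (Suc n)) (Suc m) =
    ((2 * real n + 3) * (legendre_moment (Suc n) (Suc (Suc m)) + legendre_moment (Suc n) m) / 2
      - (real n + 1) * legendre_moment n (Suc m)) / (real n + 2)"
proof -
  \<comment> \<open>All four moments vanish for the wrong parity and for m < n. At m = n two survive
    and balance by \<open>half_ratio_Suc\<close>; beyond that all four are nonzero.\<close>
  consider "odd (n + m)" | "m < n" | "m = n" | j where "m = n + 2 + 2 * j"
  proof -
    have "\<exists>j. m = n + 2 + 2 * j" if "even (n + m)" "m > n"
    proof -
      have "even (m - n)" "m - n \<noteq> 0" using that by auto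
      then obtain i where "m - n = 2 * i" "i > 0" by (metis dvdE gr0I mult_0_right)
      then have "m = n + 2 + 2 * (i - 1)" using that by simp
      then show ?thesis ..
    qed
    then show ?thesis using that by (cases m n rule: linorder_cases) auto
  qed
  then show ?thesis
  proof cases
    case 1
    then show ?thesis by (simp add: legendre_moment_parity)
  next
    case 2
    then show ?thesis by (simp add: legendre_moment_small)
  next
    case 3
    have "legendre_moment (Suc n) (Suc (Suc m)) = half_ratio (Suc n)"
      using legendre_moment_odd[of "Suc n" 0] 3 by simp
    moreover have "legendre_moment n (Suc m) = half_ratio n"
      using legendre_moment_odd[of n 0] 3 by simp
    ultimately show ?thesis
      using 3 by (simp add: legendre_moment_small half_ratio_Suc divide_simps)
        (simp add: algebra_simps)
  next
    case 4
    have m1: "legendre_moment (Suc (Suc n)) (Suc m) = half_coeff j * half_ratio (Suc (Suc (n + j)))"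
      using legendre_moment_odd[of "Suc (Suc n)" j] 4 by (simp add: algebra_simps)
    have m2: "legendre_moment (Suc n) (Suc (Suc m)) =
        half_coeff (Suc j) * half_ratio (Suc (Suc (n + j)))"
      using legendre_moment_odd[of "Suc n" "Suc j"] 4 by (simp add: algebra_simps)
    have m3: "legendre_moment (Suc n) m = half_coeff j * half_ratio (Suc (n + j))"
      using legendre_moment_odd[of "Suc n" j] 4 by (simp add: algebra_simps)
    have m4: "legendre_moment n (Suc m) = half_coeff (Suc j) * half_ratio (Suc (n + j))"
      using legendre_moment_odd[of n "Suc j"] 4 by (simp add: algebra_simps)
    \<comment> \<open>\<open>Q\<close> is a quotient of successive values of
      \<open>half_ratio\<close>, so that \<open>half_ratio (Suc (n + j))\<close> becomes a common
      factor of the four moments.\<close>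
    define Q where "Q = (real n + real j + 2) / (real n + real j + 5/2)"
    have m5: "half_ratio (Suc (Suc (n + j))) = half_ratio (Suc (n + j)) * Q"
      unfolding Q_def by (subst half_ratio_Suc) (simp add: algebra_simps)
    \<comment> \<open>The recurrence without that common factor, for a = j + 1, q = n + j + 2, b = q
      + 1/2, r = n + 1 and p = \<open>half_coeff j\<close>.\<close>
    have key: "p * (q / b) * (r + 1)
        = (2 * r + 1) * (p * (a - 1/2) / a * (q / b) + p) / 2 - r * (p * (a - 1/2) / a)"
      if "a > 0" "b > 0" "b = q + 1/2" "q = r + a" for p q r a b :: real
      using that(1,2) unfolding that(3,4) by (simp add: divide_simps) (simp add: algebra_simps)
    have Q: "half_coeff j * Q * (real n + 2)
        = (2 * real n + 3) * (half_coeff (Suc j) * Q + half_coeff j) / 2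
          - (real n + 1) * half_coeff (Suc j)"
      using key[of "real j + 1" "real n + real j + 5/2" "real n + real j + 2" "real n + 1" "half_coeff j"]
      by (simp add: half_coeff_Suc Q_def add_ac)
    have "(2 * real n + 3) * (half_coeff (Suc j) * (half_ratio (Suc (n + j)) * Q)
          + half_coeff j * half_ratio (Suc (n + j))) / 2
        - (real n + 1) * (half_coeff (Suc j) * half_ratio (Suc (n + j)))
        = half_ratio (Suc (n + j)) * ((2 * real n + 3) * (half_coeff (Suc j) * Q + half_coeff j) / 2
          - (real n + 1) * half_coeff (Suc j))"
      by (simp add: algebra_simps)
    also have "\<dots> = half_coeff j * (half_ratio (Suc (n + j)) * Q) * (real n + 2)"
      unfolding Q[symmetric] by (simp add: algebra_simps)
    finally show ?thesis
      unfolding m1 m2 m3 m4 m5 by simp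
  qed
qed

text \<open>The integrals obey the same recurrence in n as \<open>legendre_moment\<close> and agree
  with it at n = 0. The index k is arbitrary because each step uses its neighbours; k = 0 is split
  off since it has no left neighbour.\<close>

lemma legendreP_chebyshevV_has_integral:
  "((\<lambda>x. legendreP n x * chebyshevV k x) has_integral legendre_moment n k) {-1..1}"
proof (induction n arbitrary: k rule: induct_nat_012)
  case 0
  then show ?case
    using chebyshevV_has_integral[of k] by (simp add: legendre_moment_0)
next
  case 1
  show ?case
  proof (cases k)
    case 0
    then show ?thesis by (simp add: legendre_moment_small)
  next
    case (Suc m)
    have "((\<lambda>x. (chebyshevV (Suc (Suc m)) x + chebyshevV m x) / 2)
        has_integral legendre_moment 1 (Suc m)) {-1..1}"
      unfolding legendre_moment_1 legendre_moment_0
      by (intro has_integral_divide has_integral_add chebyshevV_has_integral)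
    then show ?thesis
      by (simp add: Suc)
  qed
next
  case (ge2 n)
  show ?case
  proof (cases k)
    case 0
    then show ?thesis by (simp add: legendre_moment_small)
  next
    case (Suc m)
    have eq: "((2 * real n + 3) * (legendreP (Suc n) x * chebyshevV (Suc (Suc m)) x
            + legendreP (Suc n) x * chebyshevV m x) / 2
          - (real n + 1) * (legendreP n x * chebyshevV (Suc m) x)) / (real n + 2)
        = legendreP (Suc (Suc n)) x * chebyshevV (Suc m) x" for x
      by (simp add: field_simps)
    have "((\<lambda>x. ((2 * real n + 3) * (legendreP (Suc n) x * chebyshevV (Suc (Suc m)) x
            + legendreP (Suc n) x * chebyshevV m x) / 2
          - (real n + 1) * (legendreP n x * chebyshevV (Suc m) x)) / (real n + 2))
        has_integral legendre_moment (Suc (Suc n)) (Suc m)) {-1..1}"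
      unfolding legendre_moment_Suc_Suc
      by (intro has_integral_divide has_integral_add has_integral_diff has_integral_mult_right ge2)
    then show ?thesis
      unfolding eq Suc .
  qed
qed


section \<open>Asymptotics of the moments\<close>

text \<open>By \<open>half_ratio_Suc\<close>, successive terms have the quotient (m+1)^2 /
  ((m+1/2)(m+3/2)), a factor of Wallis' product; the initial term is 2.\<close>

lemma half_ratio_wallis: "(\<lambda>m. (half_ratio m)\<^sup>2 * (real m + 1/2)) \<longlonglongrightarrow> pi"
proof -
  have "(half_ratio m)\<^sup>2 * (real m + 1/2)
      = 2 * (\<Prod>k=1..m. (4 * real k ^ 2) / (4 * real k ^ 2 - 1))" for m
  proof (induction m)
    case (Suc m)
    have "(half_ratio (Suc m))\<^sup>2 * (real (Suc m) + 1/2) = ((half_ratio m)\<^sup>2 * (real m + 1/2)) *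
        ((4 * real (Suc m) ^ 2) / (4 * real (Suc m) ^ 2 - 1))"
    proof -
      define a b c where "a = real m + 1/2" and "b = real m + 3/2" and "c = real m + 1"
      have "a > 0" "b > 0" by (auto simp: a_def b_def)
      have eqs: "4 * c ^ 2 - 1 = 4 * (a * b)" "c + 1/2 = b"
        by (auto simp: a_def b_def c_def power2_eq_square algebra_simps)
      have "(half_ratio m * c / b)\<^sup>2 * (c + 1/2)
          = (half_ratio m)\<^sup>2 * a * ((4 * c ^ 2) / (4 * c ^ 2 - 1))"
        unfolding eqs using \<open>a > 0\<close> \<open>b > 0\<close> by (simp add: power2_eq_square)
      then show ?thesis
        by (simp add: half_ratio_Suc a_def b_def c_def add.commute)
    qed
    then show ?case
      unfolding Suc by (simp add: prod.nat_ivl_Suc')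
  qed (simp add: half_ratio_0 power2_eq_square)
  then show ?thesis
    using tendsto_mult_left[OF wallis, of 2] by simp
qed

text \<open>The sequence increases to its Wallis limit, since (m+1)^2 \<ge> (m+1/2)(m+3/2).\<close>

lemma half_ratio_upper: "(half_ratio m)\<^sup>2 * (real m + 1/2) \<le> pi"
proof (rule incseq_le[OF incseq_SucI half_ratio_wallis])
  fix m
  have "1 \<le> (real m + 1)\<^sup>2 / ((real m + 1/2) * (real m + 3/2))"
    by (simp add: divide_simps power2_eq_square) (simp add: algebra_simps)
  from mult_left_mono[OF this, of "(half_ratio m)\<^sup>2 * (real m + 1/2)"]
  show "(half_ratio m)\<^sup>2 * (real m + 1/2) \<le> (half_ratio (Suc m))\<^sup>2 * (real (Suc m) + 1/2)"
    by (simp add: half_ratio_Suc power2_eq_square divide_simps) (simp add: algebra_simps)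
qed

text \<open>With the weight m + 1 the sequence decreases, since (m+1)(m+2) \<le> (m+3/2)^2, and its
  limit is the same.\<close>

lemma half_ratio_lower: "pi \<le> (half_ratio m)\<^sup>2 * (real m + 1)"
proof (rule decseq_ge[OF decseq_SucI])
  fix m
  have "(real m + 1) * (real m + 2) / (real m + 3/2)\<^sup>2 \<le> 1"
    by (simp add: divide_simps power2_eq_square) (simp add: algebra_simps)
  from mult_left_mono[OF this, of "(half_ratio m)\<^sup>2 * (real m + 1)"]
  have "(half_ratio m)\<^sup>2 * (real m + 1) * ((real m + 1) * (real m + 2) / (real m + 3/2)\<^sup>2)
      \<le> (half_ratio m)\<^sup>2 * (real m + 1)"
    by (simp only: mult_1_right) simp
  then show "(half_ratio (Suc m))\<^sup>2 * (real (Suc m) + 1) \<le> (half_ratio m)\<^sup>2 * (real m + 1)"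
    by (simp add: half_ratio_Suc power2_eq_square mult_ac add_ac)
next
  \<comment> \<open>The quotient of the weights m + 1 and m + 1/2 is 1 + (1/2) / (1/2 + m), which
    tends to 1.\<close>
  have "(\<lambda>m. 1/2 / (1/2 + real m)) \<longlonglongrightarrow> 0"
    by (intro tendsto_divide_0[OF tendsto_const] filterlim_at_top_imp_at_infinity
        filterlim_tendsto_add_at_top[OF tendsto_const] filterlim_real_sequentially)
  from tendsto_mult[OF half_ratio_wallis tendsto_add[OF tendsto_const[of 1] this]]
  have "(\<lambda>m. (half_ratio m)\<^sup>2 * (real m + 1/2) * (1 + 1/2 / (1/2 + real m))) \<longlonglongrightarrow> pi"
    by simp
  moreover have "(half_ratio m)\<^sup>2 * (real m + 1/2) * (1 + 1/2 / (1/2 + real m))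
      = (half_ratio m)\<^sup>2 * (real m + 1)" for m
  proof -
    have "(real m + 1/2) * (1 + 1/2 / (1/2 + real m)) = real m + 1"
      by (simp add: field_simps)
    then show ?thesis by (simp add: mult.assoc)
  qed
  ultimately show "(\<lambda>m. (half_ratio m)\<^sup>2 * (real m + 1)) \<longlonglongrightarrow> pi"
    by (simp only:)
qed

text \<open>The Wallis bounds place \<open>half_ratio (n + j)\<close> between sqrt(pi/(n+j+1)) and
  sqrt(pi/(n+j+1/2)). The error grows only linearly in j, so it stays summable against the powers of
  u.\<close>

lemma half_ratio_asymp:
  assumes "n \<ge> 1"
  shows "\<bar>(real n + 1/2) * half_ratio (n + j) - sqrt (real n * pi)\<bar>
    \<le> sqrt pi / sqrt (real n) * (real j + 1)"
proof -
  define s t where "s = sqrt (real n)" and "t = sqrt (real n + real j + 1)"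
  have s: "s > 0" "s\<^sup>2 = real n" and t: "t \<ge> s" "t\<^sup>2 = s\<^sup>2 + (real j + 1)"
    using assms by (auto simp: s_def t_def)
  have "((real n + 1/2) * half_ratio (n + j))\<^sup>2
      = (real n + 1/2) * ((half_ratio (n + j))\<^sup>2 * (real n + 1/2))"
    by (simp add: power2_eq_square mult_ac)
  also have "\<dots> \<le> (real n + 1/2) * ((half_ratio (n + j))\<^sup>2 * (real (n + j) + 1/2))"
    by (intro mult_left_mono) auto
  also have "\<dots> \<le> (real n + 1/2) * pi"
    by (intro mult_left_mono half_ratio_upper) auto
  \<comment> \<open>(s + 1/s)^2 = n + 2 + 1/n exceeds n + 1/2.\<close>
  also have "\<dots> \<le> (s + 1 / s)\<^sup>2 * pi"
    using s by (intro mult_right_mono) (auto simp: power2_sum power_divide)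
  also have "\<dots> = ((s + 1 / s) * sqrt pi)\<^sup>2"
    by (simp add: power_mult_distrib)
  finally have "(real n + 1/2) * half_ratio (n + j) \<le> (s + 1 / s) * sqrt pi"
    by (rule power2_le_imp_le) (use s in auto)
  moreover have "1 / s * sqrt pi \<le> sqrt pi / s * (real j + 1)"
    using s by (simp add: field_simps)
  ultimately have upper: "(real n + 1/2) * half_ratio (n + j)
      \<le> s * sqrt pi + sqrt pi / s * (real j + 1)"
    by (simp add: distrib_right)
  have "(sqrt pi / t)\<^sup>2 \<le> (half_ratio (n + j))\<^sup>2"
    using half_ratio_lower[of "n + j"] s t by (simp add: power_divide divide_simps add_ac)
  then have "sqrt pi / t \<le> half_ratio (n + j)"
    by (rule power2_le_imp_le) (simp add: less_imp_le half_ratio_pos)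
  then have "s\<^sup>2 * (sqrt pi / t) \<le> (real n + 1/2) * half_ratio (n + j)"
    using s half_ratio_pos[of "n + j"] t by (intro mult_mono) auto
  \<comment> \<open>Multiplied by s t this reads s^3 + t^3 - 2 s^2 t \<ge> 0, whose left side is (t
    - s)(t^2 + t s - s^2), with t \<ge> s.\<close>
  moreover have "s \<le> s\<^sup>2 / t + (t\<^sup>2 - s\<^sup>2) / s"
  proof -
    have "(t - s) * (t * t + (t * s - s * s)) \<ge> 0"
      using s t by (intro mult_nonneg_nonneg add_nonneg_nonneg) (auto intro: mult_right_mono)
    then have "s * s * s + t * t * t - 2 * s * s * t \<ge> 0"
      by (simp add: algebra_simps)
    then have "(s * s * s + t * t * t - 2 * s * s * t) / (s * t) \<ge> 0"
      using s(1) t(1) by (intro divide_nonneg_pos mult_pos_pos) auto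
    also have "(s * s * s + t * t * t - 2 * s * s * t) / (s * t) = s\<^sup>2 / t + (t\<^sup>2 - s\<^sup>2) / s - s"
    proof -
      have "t > 0" using s(1) t(1) by simp
      with s(1) show ?thesis
        by (simp add: divide_simps power2_eq_square) (simp add: algebra_simps)
    qed
    finally show ?thesis by simp
  qed
  then have "s * sqrt pi \<le> (s\<^sup>2 / t + (real j + 1) / s) * sqrt pi"
    unfolding t(2) by (intro mult_right_mono) auto
  moreover have "(s\<^sup>2 / t + (real j + 1) / s) * sqrt pi
      = s\<^sup>2 * (sqrt pi / t) + sqrt pi / s * (real j + 1)"
    by (simp add: algebra_simps)
  ultimately have lower: "s * sqrt pi
      \<le> (real n + 1/2) * half_ratio (n + j) + sqrt pi / s * (real j + 1)"
    by linarith
  have "sqrt (real n * pi) = s * sqrt pi"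
    by (simp add: real_sqrt_mult s_def)
  then show ?thesis
    using upper lower unfolding s_def[symmetric] by linarith
qed

section \<open>Coefficients of the Cauchy kernel\<close>

text \<open>Substitution x = cos t. The weight is singular at both ends, so the antiderivative
  -G(arccos x) is shown continuous on the closed interval and differentiated only inside.\<close>

lemma chebyshev_weight_has_integral:
  fixes h :: "real \<Rightarrow> complex"
  assumes h: "continuous_on {-1..1} h"
  shows "((\<lambda>x. h x / of_real (sqrt (1 - x\<^sup>2))) has_integral
      integral {0..pi} (\<lambda>t. h (cos t))) {-1..1}"
proof -
  define G where "G = (\<lambda>t. integral {0..t} (\<lambda>t. h (cos t)))"
  have cont: "continuous_on {0..pi} (\<lambda>t. h (cos t))"
    by (rule continuous_on_compose2[OF h]) (auto intro!: continuous_intros)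
  have contG: "continuous_on {0..pi} G"
    unfolding G_def by (intro indefinite_integral_continuous_1 integrable_continuous_real cont)
  have "((\<lambda>x. h x / of_real (sqrt (1 - x\<^sup>2))) has_integral
      (- G (arccos 1)) - (- G (arccos (-1)))) {-1..1}"
  proof (rule fundamental_theorem_of_calculus_interior)
    show "continuous_on {-1..1} (\<lambda>x. - G (arccos x))"
      by (intro continuous_on_minus continuous_on_compose2[OF contG] continuous_on_arccos')
        (auto intro: arccos_lbound arccos_ubound)
  next
    fix x :: real
    assume x: "x \<in> {-1<..<1}"
    then have ac: "arccos x \<in> {0<..<pi}"
      using arccos_lt_bounded[of x] by auto
    then have "(G has_vector_derivative h (cos (arccos x))) (at (arccos x) within {0..pi})"
      unfolding G_def by (intro integral_has_vector_derivative cont) auto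
    moreover have "at (arccos x) within {0..pi} = at (arccos x)"
      using ac by (intro at_within_interior) auto
    ultimately have "(G has_vector_derivative h x) (at (arccos x))"
      using x by simp
    moreover have "(arccos has_vector_derivative inverse (- sqrt (1 - x\<^sup>2))) (at x)"
      unfolding has_real_derivative_iff_has_vector_derivative[symmetric]
      using x by (intro DERIV_arccos) auto
    ultimately have "((G \<circ> arccos) has_vector_derivative inverse (- sqrt (1 - x\<^sup>2)) *\<^sub>R h x) (at x)"
      by (intro vector_diff_chain_at) auto
    from has_vector_derivative_minus[OF this]
    show "((\<lambda>x. - G (arccos x)) has_vector_derivative h x / of_real (sqrt (1 - x\<^sup>2))) (at x)"
      by (simp add: o_def scaleR_conv_of_real divide_inverse mult.commute)
  qed simp
  then show ?thesis
    by (simp add: G_def)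
qed

text \<open>The numbers u and 1/u are the roots of X^2 - 2 z X + 1, with u inside the unit disc; it
  is instantiated with the inverse of \<open>joukowski_out z0\<close>.\<close>

locale joukowski =
  fixes u z :: complex
  assumes u_nonzero: "u \<noteq> 0" and norm_u: "norm u < 1"
    and z_eq: "z = (u + 1 / u) / 2"
    and z_off: "z \<notin> complex_of_real ` {-1..1}"
begin

section \<open>Chebyshev coefficients of the kernel, through cosine integrals\<close>

lemma kernel_nonzero: "x \<in> {-1..1} \<Longrightarrow> of_real x - z \<noteq> 0"
  using z_off by auto

lemma cos_kernel_denom_nonzero: "of_real (cos t) - z \<noteq> 0"
  by (rule kernel_nonzero) auto

text \<open>Under x = cos t this is the Chebyshev integral of the kernel, without the factor
  2/pi.\<close>

definition cos_kernel :: "nat \<Rightarrow> complex" where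
  "cos_kernel n = integral {0..pi} (\<lambda>t. of_real (cos (real n * t)) / (of_real (cos t) - z))"

lemma cos_kernel_has_integral:
  "((\<lambda>t. of_real (cos (real n * t)) / (of_real (cos t) - z)) has_integral cos_kernel n) {0..pi}"
  unfolding cos_kernel_def using cos_kernel_denom_nonzero
  by (intro integrable_integral integrable_continuous_real continuous_intros) auto

lemma cos_has_integral_0:
  "((\<lambda>t. complex_of_real (cos (real (Suc n) * t))) has_integral 0) {0..pi}"
proof -
  have "((\<lambda>t. sin (real (Suc n) * t) / real (Suc n)) has_real_derivative cos (real (Suc n) * t)) (at t)"
    for t
    by (auto intro!: derivative_eq_intros simp: field_simps simp del: of_nat_Suc)
  then have "((\<lambda>t. cos (real (Suc n) * t)) has_integral
      sin (real (Suc n) * pi) / real (Suc n) - sin (real (Suc n) * 0) / real (Suc n)) {0..pi}"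
    by (intro fundamental_theorem_of_calculus)
      (auto simp: has_real_derivative_iff_has_vector_derivative[symmetric]
        intro: has_field_derivative_at_within simp del: of_nat_Suc)
  then have "((\<lambda>t. cos (real (Suc n) * t)) has_integral 0) {0..pi}"
    by (simp del: of_nat_Suc)
  from has_integral_of_real[OF this, where 'b = complex] show ?thesis by simp
qed

text \<open>Split cos t = z + (cos t - z); the second part cancels the denominator and integrates to
  pi.\<close>

lemma cos_kernel_1: "cos_kernel 1 = z * cos_kernel 0 + of_real pi"
proof -
  have "((\<lambda>t. z * (of_real (cos (real 0 * t)) / (of_real (cos t) - z)) + 1) has_integral
      z * cos_kernel 0 + of_real pi) {0..pi}"
    using has_integral_const_real[of "1::complex" 0 pi]
    by (intro has_integral_add has_integral_mult_right cos_kernel_has_integral)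
      (auto simp: scaleR_conv_of_real)
  moreover have "z * (of_real (cos (real 0 * t)) / (of_real (cos t) - z)) + 1
      = of_real (cos (real 1 * t)) / (of_real (cos t) - z)" for t
    using cos_kernel_denom_nonzero[of t] by (simp add: field_simps)
  ultimately show ?thesis
    using cos_kernel_has_integral[of 1] by (auto dest: has_integral_unique)
qed

text \<open>Use cos((n+2)t) = 2 cos t cos((n+1)t) - cos(nt) and split cos t = z + (cos t - z); the
  leftover 2 cos((n+1)t) integrates to 0.\<close>

lemma cos_kernel_Suc_Suc:
  "cos_kernel (Suc (Suc n)) = 2 * z * cos_kernel (Suc n) - cos_kernel n"
proof -
  have "((\<lambda>t. 2 * z * (of_real (cos (real (Suc n) * t)) / (of_real (cos t) - z))
        - of_real (cos (real n * t)) / (of_real (cos t) - z)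
        + 2 * complex_of_real (cos (real (Suc n) * t))) has_integral
      2 * z * cos_kernel (Suc n) - cos_kernel n + 2 * 0) {0..pi}"
    by (intro has_integral_add has_integral_diff has_integral_mult_right
        cos_kernel_has_integral cos_has_integral_0)
  moreover have "2 * z * (of_real (cos (real (Suc n) * t)) / (of_real (cos t) - z))
        - of_real (cos (real n * t)) / (of_real (cos t) - z)
        + 2 * complex_of_real (cos (real (Suc n) * t))
      = of_real (cos (real (Suc (Suc n)) * t)) / (of_real (cos t) - z)" for t
  proof -
    have "cos (real (Suc (Suc n)) * t) = 2 * cos t * cos (real (Suc n) * t) - cos (real n * t)"
      using chebyshevT_cos[of "Suc (Suc n)" t, unfolded chebyshevT.simps, unfolded chebyshevT_cos]
      by simp
    then show ?thesis
      using cos_kernel_denom_nonzero[of t] by (simp add: divide_simps del: of_nat_Suc)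
        (simp add: algebra_simps del: of_nat_Suc)
  qed
  ultimately show ?thesis
    using cos_kernel_has_integral[of "Suc (Suc n)"] by (auto dest: has_integral_unique)
qed

text \<open>The bound is uniform in n, as |cos| \<le> 1 and the kernel is bounded by compactness. It
  rules out the growing solution of the recurrence.\<close>

lemma cos_kernel_bounded: obtains B where "\<And>n. norm (cos_kernel n) \<le> B"
proof -
  have "compact ((\<lambda>t. 1 / (complex_of_real (cos t) - z)) ` {0..pi})"
    using cos_kernel_denom_nonzero by (intro compact_continuous_image continuous_intros) auto
  then obtain C where "\<forall>y \<in> (\<lambda>t. 1 / (complex_of_real (cos t) - z)) ` {0..pi}. norm y \<le> C"
    using compact_imp_bounded bounded_iff by metis
  then have C: "norm (1 / (complex_of_real (cos t) - z)) \<le> C" if "t \<in> {0..pi}" for t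
    using that by blast
  have "norm (cos_kernel n) \<le> C * (pi - 0)" for n
    unfolding cos_kernel_def
  proof (rule integral_bound)
    show "continuous_on {0..pi} (\<lambda>t. complex_of_real (cos (real n * t)) / (of_real (cos t) - z))"
      using cos_kernel_denom_nonzero by (intro continuous_intros) auto
  next
    fix t assume t: "t \<in> {0..pi}"
    have "norm (complex_of_real (cos (real n * t)) / (of_real (cos t) - z))
        = \<bar>cos (real n * t)\<bar> * norm (1 / (complex_of_real (cos t) - z))"
      by (simp add: norm_divide)
    also have "\<dots> \<le> 1 * C"
      by (intro mult_mono C t) auto
    finally show "norm (complex_of_real (cos (real n * t)) / (of_real (cos t) - z)) \<le> C"
      by simp
  qed simp
  then show ?thesis by (rule that)
qed

text \<open>The recurrence has the solutions $u^n$ and $u^{-n}$; boundedness excludes the latter.\<close>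
lemma cos_kernel_Suc: "cos_kernel (Suc n) = u * cos_kernel n"
proof -
  \<comment> \<open>\<open>D\<close> annihilates u^n and turns u^(-n) into a multiple of itself, so
    D_0 = u^n D_n with D_n bounded.\<close>
  define D where "D n = cos_kernel (Suc n) - u * cos_kernel n" for n
  have step: "D n = u * D (Suc n)" for n
  proof -
    have "2 * z = u + 1 / u" by (simp add: z_eq)
    then show ?thesis
      unfolding D_def cos_kernel_Suc_Suc using u_nonzero by (simp add: algebra_simps)
  qed
  have pow: "D 0 = u ^ n * D n" for n
  proof (induction n)
    case (Suc n)
    then show ?case using step[of n] by (simp add: mult_ac)
  qed simp
  obtain B where B: "\<And>n. norm (cos_kernel n) \<le> B" using cos_kernel_bounded by blast
  have "norm (D n) \<le> B + 1 * B" for n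
  proof -
    have "norm u * norm (cos_kernel n) \<le> 1 * B"
      using norm_u by (intro mult_mono B) auto
    then show ?thesis
      unfolding D_def using norm_triangle_ineq4[of "cos_kernel (Suc n)" "u * cos_kernel n"] B[of "Suc n"]
      by (simp add: norm_mult)
  qed
  then have "norm (D 0) \<le> norm u ^ n * (2 * B)" for n
    unfolding pow[of n] by (auto simp: norm_mult norm_power intro!: mult_left_mono)
  moreover have "(\<lambda>n. norm u ^ n * (2 * B)) \<longlonglongrightarrow> 0"
    using tendsto_mult_left_zero[OF LIMSEQ_power_zero[of "norm u"]] norm_u by simp
  ultimately have "norm (D 0) \<le> 0"
    by (intro LIMSEQ_le_const) auto
  then have "D n = 0" for n
    using pow[of n] u_nonzero by simp
  then show ?thesis by (simp add: D_def)
qed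

text \<open>\<open>cos_kernel_1\<close> and \<open>cos_kernel_Suc\<close> determine the initial
  value from (u - z) K_0 = pi; u = z would force u^2 = 1.\<close>

lemma cos_kernel_eq: "cos_kernel n = u ^ n * (of_real pi / (u - z))"
proof (induction n)
  case 0
  have "u \<noteq> z"
  proof
    assume "u = z"
    then have "u\<^sup>2 = 1"
      using z_eq u_nonzero by (simp add: field_simps power2_eq_square)
    then have "norm u ^ 2 = 1" by (metis norm_one norm_power)
    then have "norm u = 1 \<or> norm u = - 1" by (simp only: power2_eq_1_iff)
    then show False using norm_u norm_ge_zero[of u] by linarith
  qed
  then show ?case
    using cos_kernel_1 cos_kernel_Suc[of 0] by (simp add: field_simps)
qed (simp add: cos_kernel_Suc)

lemma chebyshev_coeff_kernel:
  "chebyshev_coeff (\<lambda>x. 1 / (of_real x - z)) n = 2 * u ^ n / (u - z)"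
proof -
  have "continuous_on {-1..1} (\<lambda>x. complex_of_real (chebyshevT n x) / (of_real x - z))"
    using kernel_nonzero chebyshevT_deriv[of n]
    by (intro continuous_intros DERIV_continuous_on) (auto intro: has_field_derivative_at_within)
  from chebyshev_weight_has_integral[OF this]
  have "integral {-1..1} (\<lambda>x. 1 / (of_real x - z) * of_real (chebyshevT n x / sqrt (1 - x\<^sup>2)))
      = cos_kernel n"
    by (simp add: integral_unique chebyshevT_cos cos_kernel_def field_simps)
  then show ?thesis
    by (simp add: chebyshev_coeff_def cos_kernel_eq)
qed

section \<open>Legendre coefficients of the kernel, through the generating function of the
  U_k\<close>

lemma chebyshevV_sum:
  "(1 - 2 * of_real x * u + u\<^sup>2) * (\<Sum>k<Suc n. u ^ k * of_real (chebyshevV k x))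
    = u - u ^ Suc n * of_real (chebyshevV (Suc n) x)
      + u\<^sup>2 * (u ^ n * of_real (chebyshevV n x))"
proof (induction n)
  case (Suc n)
  show ?case
    unfolding sum.lessThan_Suc[of _ "Suc n"] distrib_left Suc
    by (simp add: algebra_simps power2_eq_square)
qed simp

text \<open>The common majorant: for the linearly growing V_k here, and for the error terms of
  weight j + 1 later.\<close>

lemma summable_Suc_norm_u: "summable (\<lambda>k. real (Suc k) * norm u ^ k)"
  using geometric_deriv_sums[of "norm u"] norm_u by (auto dest: sums_summable)

lemma norm_chebyshevV_term_le:
  assumes "x \<in> {-1..1}"
  shows "norm (u ^ k * of_real (chebyshevV k x)) \<le> real (Suc k) * norm u ^ k"
proof -
  have "\<bar>chebyshevV k x\<bar> \<le> real k"
    using assms by (intro abs_chebyshevV_le) (auto simp: abs_le_iff)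
  then have "\<bar>chebyshevV k x\<bar> * norm u ^ k \<le> real (Suc k) * norm u ^ k"
    by (intro mult_right_mono) auto
  then show ?thesis
    by (simp add: norm_mult norm_power mult.commute)
qed

text \<open>Limit of the telescoped identity \<open>chebyshevV_sum\<close>, whose boundary terms
  tend to 0 as terms of a convergent series.\<close>

lemma chebyshevV_sums:
  assumes x: "x \<in> {-1..1}"
  shows "(\<lambda>k. u ^ k * of_real (chebyshevV k x)) sums (1 / (2 * (z - of_real x)))"
proof -
  define q where "q k = u ^ k * of_real (chebyshevV k x)" for k
  have "summable q"
    using norm_chebyshevV_term_le[OF x]
    by (intro summable_comparison_test'[OF summable_Suc_norm_u]) (auto simp: q_def)
  then have q0: "q \<longlonglongrightarrow> 0" by (rule summable_LIMSEQ_zero)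
  \<comment> \<open>From 2 z = u + 1/u; the factor u later cancels the numerator u left in the
    limit.\<close>
  have eq: "1 - 2 * of_real x * u + u\<^sup>2 = 2 * u * (z - of_real x)"
    using u_nonzero by (simp add: z_eq field_simps power2_eq_square)
  have nz: "z - of_real x \<noteq> 0"
    using kernel_nonzero[OF x] by auto
  have "(\<Sum>k<Suc n. q k) = (u - q (Suc n) + u\<^sup>2 * q n) / (2 * u * (z - of_real x))" for n
    using chebyshevV_sum[of x n] u_nonzero nz unfolding eq q_def
    by (simp add: nonzero_eq_divide_eq mult.commute del: sum.lessThan_Suc)
  moreover have "(\<lambda>n. (u - q (Suc n) + u\<^sup>2 * q n) / (2 * u * (z - of_real x)))
      \<longlonglongrightarrow> (u - 0 + u\<^sup>2 * 0) / (2 * u * (z - of_real x))"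
    using u_nonzero nz by (intro tendsto_intros q0 LIMSEQ_Suc[OF q0]) auto
  ultimately have "(\<lambda>n. \<Sum>k<Suc n. q k) \<longlonglongrightarrow> 1 / (2 * (z - of_real x))"
    using u_nonzero by simp
  then show ?thesis
    unfolding sums_def q_def[symmetric] by (rule LIMSEQ_imp_Suc)
qed

text \<open>P_n is bounded on [-1,1], so the Weierstrass test gives uniform convergence and the
  series may be integrated term by term.\<close>

lemma legendre_moment_sums:
  "(\<lambda>k. u ^ k * of_real (legendre_moment n k)) sums
    integral {-1..1} (\<lambda>x. 1 / (2 * (z - of_real x)) * of_real (legendreP n x))"
proof -
  define q where "q k x = u ^ k * of_real (chebyshevV k x) * complex_of_real (legendreP n x)" for k x
  have "compact (legendreP n ` {-1..1})"
    by (intro compact_continuous_image continuous_legendreP) auto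
  then obtain B where "\<forall>y \<in> legendreP n ` {-1..1}. norm y \<le> B"
    using compact_imp_bounded bounded_iff by metis
  then have B: "\<bar>legendreP n x\<bar> \<le> B" if "x \<in> {-1..1}" for x
    using that by auto
  have "norm (q k x) \<le> real (Suc k) * norm u ^ k * B" if "x \<in> {-1..1}" for k x
    unfolding q_def norm_mult[of _ "complex_of_real (legendreP n x)"] norm_of_real
    using that by (intro mult_mono norm_chebyshevV_term_le B) auto
  then have lim: "uniform_limit {-1..1} (\<lambda>N x. \<Sum>k<N. q k x) (\<lambda>x. \<Sum>k. q k x) sequentially"
    by (rule Weierstrass_m_test) (assumption | rule summable_mult2 summable_Suc_norm_u)+
  have "continuous_on {-1..1} (\<lambda>x. \<Sum>k<N. q k x)" for N
    unfolding q_def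
    by (intro continuous_intros continuous_chebyshevV continuous_legendreP)
  then obtain I J where
    I: "\<And>N. ((\<lambda>x. \<Sum>k<N. q k x) has_integral I N) {-1..1}" and
    J: "((\<lambda>x. \<Sum>k. q k x) has_integral J) {-1..1}" "I \<longlonglongrightarrow> J"
    using uniform_limit_integral[OF lim] by (metis trivial_limit_sequentially)
  have "((\<lambda>x. q k x) has_integral u ^ k * of_real (legendre_moment n k)) {-1..1}" for k
    using has_integral_mult_right[OF
        has_integral_of_real[OF legendreP_chebyshevV_has_integral[of n k]], of "u ^ k"]
    by (simp add: q_def mult_ac)
  then have "((\<lambda>x. \<Sum>k<N. q k x) has_integral
      (\<Sum>k<N. u ^ k * of_real (legendre_moment n k))) {-1..1}" for N
    by (intro has_integral_sum) auto
  then have "I N = (\<Sum>k<N. u ^ k * of_real (legendre_moment n k))" for N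
    using I[of N] has_integral_unique by blast
  then have "I = (\<lambda>N. \<Sum>k<N. u ^ k * of_real (legendre_moment n k))"
    by (rule ext)
  moreover have "(\<Sum>k. q k x) = 1 / (2 * (z - of_real x)) * of_real (legendreP n x)"
    if "x \<in> {-1..1}" for x
    unfolding q_def using sums_mult2[OF chebyshevV_sums[OF that]] by (rule sums_unique[symmetric])
  then have "integral {-1..1} (\<lambda>x. \<Sum>k. q k x)
      = integral {-1..1} (\<lambda>x. 1 / (2 * (z - of_real x)) * of_real (legendreP n x))"
    by (intro integral_cong) auto
  ultimately show ?thesis
    using J by (simp add: sums_def integral_unique)
qed

text \<open>Only the indices k = n + 2j + 1 contribute to \<open>legendre_moment_sums\<close>.
  Passing from 1/(2(z-x)) to 1/(x-z) costs a factor -2, which turns n + 1/2 into -(2n+1).\<close>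

lemma legendre_coeff_kernel_sums:
  "(\<lambda>j. - (2 * of_nat n + 1) * u ^ Suc n * of_real (half_coeff j * half_ratio (n + j)) * u ^ (2 * j))
    sums legendre_coeff (\<lambda>x. 1 / (of_real x - z)) n"
proof -
  have "strict_mono (\<lambda>j. Suc (n + 2 * j))"
    by (auto simp: strict_mono_def)
  moreover have "u ^ k * of_real (legendre_moment n k) = 0" if "k \<notin> range (\<lambda>j. Suc (n + 2 * j))" for k
  proof (cases "k \<le> n \<or> even (k - n)")
    case False
    then obtain j where "k - n = 2 * j + 1" "n < k" by (metis oddE not_le)
    then have "k = Suc (n + 2 * j)" by simp
    then show ?thesis using that by blast
  qed (simp add: legendre_moment_def)
  ultimately have "(\<lambda>j. u ^ Suc (n + 2 * j) * of_real (legendre_moment n (Suc (n + 2 * j)))) sums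
      integral {-1..1} (\<lambda>x. 1 / (2 * (z - of_real x)) * of_real (legendreP n x))"
    using sums_mono_reindex[of "\<lambda>j. Suc (n + 2 * j)"
        "\<lambda>k. u ^ k * complex_of_real (legendre_moment n k)"] legendre_moment_sums[of n]
    by blast
  then have "(\<lambda>j. - (2 * of_nat n + 1) * (u ^ Suc (n + 2 * j) *
        of_real (legendre_moment n (Suc (n + 2 * j))))) sums
      (- (2 * of_nat n + 1) *
        integral {-1..1} (\<lambda>x. 1 / (2 * (z - of_real x)) * of_real (legendreP n x)))"
    by (rule sums_mult)
  moreover have "legendre_coeff (\<lambda>x. 1 / (of_real x - z)) n = - (2 * of_nat n + 1) *
        integral {-1..1} (\<lambda>x. 1 / (2 * (z - of_real x)) * of_real (legendreP n x))"
  proof -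
    have "1 / (of_real x - z) * of_real (legendreP n x)
        = - 2 * (1 / (2 * (z - of_real x)) * of_real (legendreP n x))" for x
    proof -
      \<comment> \<open>Valid for d = 0 too, where division by zero makes both sides 0; hence
        \<open>x\<close> can be arbitrary.\<close>
      have "1 / - d * p = - 2 * (1 / (2 * d) * p)" for d p :: complex
        by simp
      from this[of "z - of_real x"] show ?thesis by (simp only: minus_diff_eq)
    qed
    then have "integral {-1..1} (\<lambda>x. 1 / (of_real x - z) * of_real (legendreP n x))
        = integral {-1..1} (\<lambda>x. - 2 * (1 / (2 * (z - of_real x)) * of_real (legendreP n x)))"
      by (intro integral_cong) auto
    also have "\<dots> = - 2 * integral {-1..1} (\<lambda>x. 1 / (2 * (z - of_real x)) * of_real (legendreP n x))"
      by (rule integral_mult_right)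
    finally show ?thesis
      unfolding legendre_coeff_def by (simp add: algebra_simps)
  qed
  moreover have "- (2 * of_nat n + 1) * (u ^ Suc (n + 2 * j) *
        of_real (legendre_moment n (Suc (n + 2 * j))))
      = - (2 * of_nat n + 1) * u ^ Suc n * of_real (half_coeff j * half_ratio (n + j)) * u ^ (2 * j)" for j
    unfolding legendre_moment_odd by (simp add: power_add)
  ultimately show ?thesis
    by (simp only:)
qed

section \<open>The ratio of the coefficients and its error\<close>

lemma half_coeff_sums:
  "(\<lambda>j. of_real (half_coeff j) * u ^ (2 * j)) sums (1 - u\<^sup>2) powr (-1/2)"
proof -
  have "norm (- (u\<^sup>2)) < 1"
    using norm_u by (simp add: norm_power power_less_one_iff)
  from gen_binomial_complex[OF this, of "-1/2"]
  have "(\<lambda>j. (-1/2 gchoose j) * (- (u\<^sup>2)) ^ j) sums (1 - u\<^sup>2) powr (-1/2)"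
    by simp
  \<comment> \<open>The sign (-1)^j in the Pochhammer form of the binomial coefficient cancels the
    sign in the power of -u^2.\<close>
  moreover have "(-1/2 gchoose j) * (- (u\<^sup>2)) ^ j = of_real (half_coeff j) * u ^ (2 * j)" for j
  proof -
    have "complex_of_real (pochhammer (1/2) j) = pochhammer (1/2) j"
      using pochhammer_of_real[of "1/2" j, where 'a = complex] by simp
    then have half: "pochhammer (1/2) j / fact j = complex_of_real (half_coeff j)"
      by (simp add: half_coeff_def)
    have "(-1/2 gchoose j) * (- (u\<^sup>2)) ^ j
        = ((-1) ^ j * (-1) ^ j) * (pochhammer (1/2) j / fact j) * u ^ (2 * j)"
      by (subst power_minus) (simp add: gbinomial_pochhammer power_mult)
    also have "(-1) ^ j * (-1) ^ j = (1::complex)"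
      by (simp flip: power_mult_distrib)
    finally show ?thesis
      by (simp add: half)
  qed
  ultimately show ?thesis by (simp only:)
qed

text \<open>Subtracting sqrt(n pi) times the binomial series term by term leaves the deviations
  \<open>e j\<close>, which \<open>half_ratio_asymp\<close> controls. Apart from 1/sqrt n, the bound
  is independent of n.\<close>

lemma norm_coeff_ratio_error_le:
  assumes n: "n \<ge> 1"
  defines "f \<equiv> \<lambda>x. 1 / (complex_of_real x - z)"
  shows "norm (legendre_coeff f n / chebyshev_coeff f n
      - (1 - u\<^sup>2) / 2 * (1 - u\<^sup>2) powr (-1/2) * of_real (sqrt (real n * pi)))
    \<le> norm ((1 - u\<^sup>2) / 2) * (sqrt pi * (\<Sum>j. real (Suc j) * norm u ^ j)) * (1 / sqrt (real n))"
proof -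
  define e where "e j = (real n + 1/2) * half_ratio (n + j) - sqrt (real n * pi)" for j
  define r where "r j = of_real (half_coeff j * e j) * u ^ (2 * j)" for j
  have cheb: "chebyshev_coeff f n = 4 * u ^ Suc n / (u\<^sup>2 - 1)"
  proof -
    have "u - z = (u\<^sup>2 - 1) / (2 * u)"
      using u_nonzero by (simp add: z_eq field_simps power2_eq_square)
    then show ?thesis
      using u_nonzero by (simp add: f_def chebyshev_coeff_kernel)
  qed
  have "(\<lambda>j. - (2 * of_nat n + 1) * u ^ Suc n * of_real (half_coeff j * half_ratio (n + j))
        * u ^ (2 * j) / chebyshev_coeff f n) sums (legendre_coeff f n / chebyshev_coeff f n)"
    unfolding f_def by (intro sums_divide legendre_coeff_kernel_sums)
  \<comment> \<open>The power u^(n+1) cancels, and -(2n+1)(u^2-1)/4 is (1-u^2)/2 times n +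
    1/2.\<close>
  moreover have "- (2 * of_nat n + 1) * u ^ Suc n * of_real (half_coeff j * half_ratio (n + j))
        * u ^ (2 * j) / chebyshev_coeff f n
      = (1 - u\<^sup>2) / 2 * (of_real (half_coeff j * ((real n + 1/2) * half_ratio (n + j))) * u ^ (2 * j))"
    for j
    using u_nonzero unfolding cheb by (simp add: field_simps)
  ultimately have "(\<lambda>j. (1 - u\<^sup>2) / 2 *
        (of_real (half_coeff j * ((real n + 1/2) * half_ratio (n + j))) * u ^ (2 * j)))
      sums (legendre_coeff f n / chebyshev_coeff f n)"
    by (simp only:)
  from sums_diff[OF this sums_mult2[OF sums_mult[OF half_coeff_sums, of "(1 - u\<^sup>2) / 2"],
      of "of_real (sqrt (real n * pi))"]]
  have *: "(\<lambda>j. (1 - u\<^sup>2) / 2 * r j) sums (legendre_coeff f n / chebyshev_coeff f n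
      - (1 - u\<^sup>2) / 2 * (1 - u\<^sup>2) powr (-1/2) * of_real (sqrt (real n * pi)))"
    by (rule back_subst[of "\<lambda>q. q sums _"]) (simp add: r_def e_def algebra_simps fun_eq_iff)
  have r: "norm (r j) \<le> sqrt pi / sqrt (real n) * (real (Suc j) * norm u ^ j)" for j
  proof -
    have "norm (r j) = half_coeff j * \<bar>e j\<bar> * norm u ^ (2 * j)"
      by (simp add: r_def norm_mult norm_power abs_mult half_coeff_nonneg)
    \<comment> \<open>The exponent 2j is weakened to j in order to reach the common
      majorant.\<close>
    also have "\<dots> \<le> 1 * (sqrt pi / sqrt (real n) * (real j + 1)) * norm u ^ j"
      using norm_u half_ratio_asymp[OF n, of j] half_coeff_nonneg half_coeff_le_1
      by (intro mult_mono power_decreasing) (auto simp: e_def)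
    finally show ?thesis by (simp add: mult_ac add_ac)
  qed
  have summ: "summable (\<lambda>j. sqrt pi / sqrt (real n) * (real (Suc j) * norm u ^ j))"
    by (intro summable_mult summable_Suc_norm_u)
  have "summable r"
    using r by (intro summable_comparison_test'[OF summ]) auto
  then have eq: "legendre_coeff f n / chebyshev_coeff f n
      - (1 - u\<^sup>2) / 2 * (1 - u\<^sup>2) powr (-1/2) * of_real (sqrt (real n * pi))
      = (1 - u\<^sup>2) / 2 * suminf r"
    by (rule sums_unique2[OF * sums_mult[OF summable_sums]])
  have "norm (suminf r) \<le> sqrt pi / sqrt (real n) * (\<Sum>j. real (Suc j) * norm u ^ j)"
    using norm_suminf_le[OF r summ] unfolding suminf_mult[OF summable_Suc_norm_u] .
  then have "norm ((1 - u\<^sup>2) / 2) * norm (suminf r)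
      \<le> norm ((1 - u\<^sup>2) / 2) * (sqrt pi / sqrt (real n) * (\<Sum>j. real (Suc j) * norm u ^ j))"
    by (rule mult_left_mono) simp
  then show ?thesis
    unfolding eq norm_mult by (simp add: mult_ac)
qed

end

section \<open>The inverse Joukowski map and the function g\<close>

lemma joukowski_out:
  assumes "z \<notin> complex_of_real ` {-1..1}"
  shows "norm (joukowski_out z) > 1" "z = (joukowski_out z + 1 / joukowski_out z) / 2"
proof -
  define s where "s = csqrt (z\<^sup>2 - 1)"
  have prod: "(z + s) * (z - s) = 1"
    by (simp add: s_def algebra_simps flip: power2_eq_square)
  then have nz: "z + s \<noteq> 0" "z - s \<noteq> 0" by auto
  have ns: "norm (z + s) * norm (z - s) = 1"
    using prod by (metis norm_mult norm_one)
  \<comment> \<open>On the unit circle the inverse z - s of z + s would be its conjugate, making z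
    the real part of z + s and hence a point of [-1,1].\<close>
  have "norm (z + s) \<noteq> 1"
  proof
    assume 1: "norm (z + s) = 1"
    then have "z - s = cnj (z + s)"
      using prod complex_norm_square[of "z + s"] nz(1) by (metis mult_left_cancel of_real_1 power_one)
    then have "2 * z = of_real (2 * Re (z + s))"
      using complex_add_cnj[of "z + s"] by (metis add.commute add_diff_cancel_left' diff_add_eq mult_2)
    then have "2 * z = 2 * of_real (Re (z + s))"
      by (simp only: of_real_mult of_real_numeral)
    then have "z = of_real (Re (z + s))"
      by (simp only: mult_cancel_left) simp
    moreover have "\<bar>Re (z + s)\<bar> \<le> 1" using abs_Re_le_cmod[of "z + s"] 1 by simp
    ultimately show False using assms by (metis abs_le_iff atLeastAtMost_iff image_eqI minus_le_iff)
  qed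
  \<comment> \<open>The two moduli multiply to 1 and the first is not 1, so one of them exceeds
    1.\<close>
  then have "norm (z - s) > 1" if "\<not> norm (z + s) > 1"
  proof -
    have "norm (z + s) < 1" using that \<open>norm (z + s) \<noteq> 1\<close> by simp
    then have "norm (z + s) * norm (z - s) < 1 * norm (z - s)"
      using nz by (intro mult_strict_right_mono) auto
    then show ?thesis using ns by simp
  qed
  then show "norm (joukowski_out z) > 1"
    by (simp add: joukowski_out_def s_def)
  have "1 / (z + s) = z - s" "1 / (z - s) = z + s"
    using prod nz by (auto simp: field_simps)
  then show "z = (joukowski_out z + 1 / joukowski_out z) / 2"
    by (simp add: joukowski_out_def flip: s_def)
qed

text \<open>With w = \<open>joukowski_out z\<close>, z^2 - 1 = (w^2 - 1)(1 - u^2)/4, so the radicand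
  is (1 - u^2)/4. The right-hand side is the form in which the binomial series delivers the
  limit.\<close>

lemma g_fun_eq:
  assumes "z \<notin> complex_of_real ` {-1..1}"
  defines "u \<equiv> 1 / joukowski_out z"
  shows "g_fun z = (1 - u\<^sup>2) / 2 * (1 - u\<^sup>2) powr (-1/2)"
proof -
  note w = joukowski_out[OF assms(1)]
  have nz: "joukowski_out z \<noteq> 0" using w(1) by auto
  have "(joukowski_out z)\<^sup>2 \<noteq> 1"
  proof
    assume "(joukowski_out z)\<^sup>2 = 1"
    then have "norm (joukowski_out z) ^ 2 = 1" by (metis norm_one norm_power)
    moreover have "norm (joukowski_out z) ^ 2 > 1" using w(1) by simp
    ultimately show False by simp
  qed
  then have nz1: "(joukowski_out z)\<^sup>2 - 1 \<noteq> 0" and nz2: "1 - u\<^sup>2 \<noteq> 0"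
    using nz by (auto simp: u_def power_divide)
  have "z\<^sup>2 - 1 = ((joukowski_out z)\<^sup>2 - 1) * ((1 - u\<^sup>2) / 4)"
    using nz by (subst w(2)) (simp add: u_def field_simps power2_eq_square)
  then have "(z\<^sup>2 - 1) / ((joukowski_out z)\<^sup>2 - 1) = (1 - u\<^sup>2) / 4"
    using nz1 by simp
  then have "g_fun z = csqrt ((1 - u\<^sup>2) / 4)"
    by (simp only: g_fun_def)
  \<comment> \<open>Halving does not change the argument, so the root stays on the principal
    branch.\<close>
  also have "\<dots> = csqrt (1 - u\<^sup>2) / 2"
    using csqrt_principal[of "1 - u\<^sup>2"]
    by (intro csqrt_unique) (auto simp: power_divide)
  also have "csqrt (1 - u\<^sup>2) = (1 - u\<^sup>2) powr (1 + (-1/2))"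
    by (simp add: csqrt_conv_powr)
  also have "\<dots> = (1 - u\<^sup>2) * (1 - u\<^sup>2) powr (-1/2)"
    using nz2 by (subst powr_add) simp
  finally show ?thesis by simp
qed

theorem theorem5p4:
  fixes z0 :: complex
  assumes "z0 \<notin> complex_of_real ` {-1..1}"
  defines "f \<equiv> (\<lambda>x::real. 1 / (complex_of_real x - z0))"
  shows "(\<lambda>n. legendre_coeff f n / chebyshev_coeff f n - g_fun z0 * of_real (sqrt (real n * pi)))
           \<in> O(\<lambda>n. of_real (1 / sqrt (real n)))"
proof -
  define u where "u = 1 / joukowski_out z0"
  note w = joukowski_out[OF assms(1)]
  interpret joukowski u z0
  proof
    show "u \<noteq> 0" "norm u < 1" "z0 = (u + 1 / u) / 2"
      using w by (auto simp: u_def norm_divide add.commute divide_less_eq)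
  qed (rule assms(1))
  have g: "g_fun z0 = (1 - u\<^sup>2) / 2 * (1 - u\<^sup>2) powr (-1/2)"
    unfolding u_def by (rule g_fun_eq[OF assms(1)])
  show ?thesis
  \<comment> \<open>The constant depends on \<open>z0\<close> only, through u; the error bound
    applies from n = 1 on.\<close>
  proof (rule bigoI)
    show "\<forall>\<^sub>F n in sequentially.
        norm (legendre_coeff f n / chebyshev_coeff f n - g_fun z0 * of_real (sqrt (real n * pi)))
        \<le> norm ((1 - u\<^sup>2) / 2) * (sqrt pi * (\<Sum>j. real (Suc j) * norm u ^ j))
          * norm (complex_of_real (1 / sqrt (real n)))"
      using eventually_ge_at_top[of 1]
    proof eventually_elim
      case (elim n)
      have "norm (complex_of_real (1 / sqrt (real n))) = 1 / sqrt (real n)"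
        unfolding norm_of_real by simp
      then show ?case
        unfolding g f_def using norm_coeff_ratio_error_le[OF elim] by (simp only:)
    qed
  qed
qed

end
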